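(* Let $n\ge 2$. For a word $\beta$ in the generators $a_i,b_i,c_i,c_i^{-1},v_i$ ($1\le i\le n-1$) of the virtual surface singular braid monoid $VSSB_n$, let $\phi_n(\beta)\in G_n^2$ be the first component of $\beta\cdot(1,1)\in G_n^2\times\Sigma_n$, where the letters of $\beta$ act on $G_n^2\times \Sigma_n$ by the formulas given in the context. Then: 1. $\phi_n$ is a well-defined map from the monoid $VSSB_n$ to the set $G_n^2$; that is, $\phi_n(\beta)$ depends only on the element of $VSSB_n$ represented by the word $\beta$. 2. The restriction of $\phi_n$ to the virtual pure surface singular braid monoid $VPSSB_n$ is a homomorphism to the group $G_n^2$.
   Context: The group $G_n^2$ is given by generators $a_{ij}$ indexed by the unordered pairs $\{i,j\}\subset\{1,\dots,n\}$, $i\neq j$ (so $a_{ij}=a_{ji}$; we also write $a_{i,j}$), and relations: $a_{ij}^2=1$; $a_{ij}a_{kl}=a_{kl}a_{ij}$ for distinct $i,j,k,l$; $a_{ij}a_{ik}a_{jk}=a_{jk}a_{ik}a_{ij}$ for distinct $i,j,k$. These generators $a_{ij}$ (two indices) are unrelated to the monoid generators $a_i$ (one index) below. $VSSB_n$ is the monoid with generators $a_i,b_i,c_i,c_i^{-1},v_i$, $1\le i\le n-1$, and the following relations. In (A1)-(A11), $i,j,k\in\{1,\dots,n-1\}$, $|k-i|=1$, and $x_i,y_i\in\{a_i,b_i,c_i,c_i^{-1}\}$, where the same letter $x$ with different indices denotes generators of the same type. All relations are imposed whenever all indices lie in $\{1,\dots,n-1\}$. - (A1) $c_ic_i^{-1}=1=c_i^{-1}c_i$;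 - (A2) $x_iy_j=y_jx_i$ for $|i-j|>1$; - (A3) $x_ic_kc_i=c_kc_ix_k$; - (A4) $x_ic_k^{-1}c_i^{-1}=c_k^{-1}c_i^{-1}x_k$; - (A5) $a_ib_k=b_ka_i$; - (A6) $a_ib_{i-2}(c_{i-1}c_{i-2}c_ic_{i-1})^2=a_ib_{i-2}$ for $i>2$; - (A7) $b_ia_{i-2}(c_{i-1}c_{i-2}c_ic_{i-1})^2=b_ia_{i-2}$ for $i>2$; - (A8) $a_i^2=a_i$; - (A9) $b_i^2=b_i$; - (A10) $a_ib_ic_i^2=a_ib_i$; - (A11) $a_ib_k(c_ic_kc_i)^2=a_ib_k$; - (V1) $v_ix_j=x_jv_i$ for $|i-j|>1$, $x_j\in\{a_j,b_j,c_j,c_j^{-1},v_j\}$; - (V2) $v_i^2=1$; - (V3) $x_iv_{i\pm1}v_i=v_{i\pm1}v_ix_{i\pm1}$, where $x_j\in\{a_j,b_j,c_j,c_j^{-1},v_j\}$ for $j=i,i\pm1$; - (V4) $x_iv_i=v_ix_i$ for $x_i\in\{a_i,b_i\}$. $\Sigma_n$ is the group of permutations of $\{1,\dots,n\}$, with $(\sigma\cdot\tau)(j)=\sigma(\tau(j))$, and $(i\ i{+}1)$ is the transposition of $i$ and $i+1$. There is a homomorphism $\rho_n: VSSB_n\to\Sigma_n$ with $\rho_n(a_i)=\rho_n(b_i)=1$ and $\rho_n(c_i)=\rho_n(c_i^{-1})=\rho_n(v_i)=(i\ i{+}1)$. The virtual pure surface singular braid monoid is the submonoid $VPSSB_n=\{\beta\in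 VSSB_n:\rho_n(\beta)=1\}$. For $(g,\sigma)\in G_n^2\times\Sigma_n$ the generators act by $$c_i\cdot(g,\sigma)=c_i^{-1}\cdot(g,\sigma)=(a_{\sigma(i),\sigma(i+1)}\,g,\ \sigma\cdot(i\ i{+}1)),$$ $$a_i\cdot(g,\sigma)=b_i\cdot(g,\sigma)=(g,\sigma),\qquad v_i\cdot(g,\sigma)=(g,\ \sigma\cdot(i\ i{+}1)).$$ A word acts as a left action: $(xy)\cdot(g,\sigma)=x\cdot(y\cdot(g,\sigma))$. *)

theory Defs
  imports "HOL-Algebra.Sym_Groups"
begin

section \<open>Monoids and groups given by generators and relations\<close>

text \<open>The congruence on the free monoid \<^term>\<open>lists X\<close> generated by the pairs of words in \<^term>\<open>R\<close>.\<close>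

inductive_set pres_cong :: "'a set \<Rightarrow> ('a list \<times> 'a list) set \<Rightarrow> ('a list \<times> 'a list) set"
  for X :: "'a set" and R :: "('a list \<times> 'a list) set" where
  rel: "(u, v) \<in> R \<Longrightarrow> u \<in> lists X \<Longrightarrow> v \<in> lists X \<Longrightarrow> p \<in> lists X \<Longrightarrow> q \<in> lists X
    \<Longrightarrow> (p @ u @ q, p @ v @ q) \<in> pres_cong X R"
| refl: "w \<in> lists X \<Longrightarrow> (w, w) \<in> pres_cong X R"
| sym: "(u, v) \<in> pres_cong X R \<Longrightarrow> (v, u) \<in> pres_cong X R"
| trans: "(u, v) \<in> pres_cong X R \<Longrightarrow> (v, w) \<in> pres_cong X R \<Longrightarrow> (u, w) \<in> pres_cong X R"

definition pres_class :: "'a set \<Rightarrow> ('a list \<times> 'a list) set \<Rightarrow> 'a list \<Rightarrow> 'a list set" where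
  "pres_class X R w = pres_cong X R `` {w}"

definition pres_monoid :: "'a set \<Rightarrow> ('a list \<times> 'a list) set \<Rightarrow> 'a list set monoid" where
  "pres_monoid X R =
    \<lparr> carrier = lists X // pres_cong X R,
      mult = (\<lambda>P Q. \<Union>u\<in>P. \<Union>v\<in>Q. pres_class X R (u @ v)),
      one = pres_class X R [] \<rparr>"

text \<open>Group words are lists over \<^term>\<open>X \<times> (UNIV :: bool set)\<close>: the letter \<^term>\<open>(x, True)\<close> is the
  generator \<^term>\<open>x\<close> and \<^term>\<open>(x, False)\<close> is its formal inverse.\<close>

definition group_letters :: "'a set \<Rightarrow> ('a \<times> bool) set" where
  "group_letters X = X \<times> UNIV"

definition cancel_rels :: "'a set \<Rightarrow> (('a \<times> bool) list \<times> ('a \<times> bool) list) set" where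
  "cancel_rels X = {([(x, b), (x, \<not> b)], []) | x b. x \<in> X}"

definition pres_group ::
  "'a set \<Rightarrow> (('a \<times> bool) list \<times> ('a \<times> bool) list) set \<Rightarrow> ('a \<times> bool) list set monoid" where
  "pres_group X R = pres_monoid (group_letters X) (cancel_rels X \<union> R)"

lemma pres_cong_lists: "(u, v) \<in> pres_cong X R \<Longrightarrow> u \<in> lists X \<and> v \<in> lists X"
  by (induction rule: pres_cong.induct) auto

lemma equiv_pres_cong: "equiv (lists X) (pres_cong X R)"
proof (rule equivI)
  show "pres_cong X R \<subseteq> lists X \<times> lists X"
    using pres_cong_lists by fastforce
  show "refl_on (lists X) (pres_cong X R)"
    by (auto simp: refl_on_def intro: pres_cong.refl)
  show "sym (pres_cong X R)"
    by (rule symI) (rule pres_cong.sym)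
  show "trans (pres_cong X R)"
    by (rule transI) (rule pres_cong.trans)
qed

lemma pres_cong_context:
  assumes "(u, v) \<in> pres_cong X R" "p \<in> lists X" "q \<in> lists X"
  shows "(p @ u @ q, p @ v @ q) \<in> pres_cong X R"
  using assms
proof (induction rule: pres_cong.induct)
  case (rel u v p' q')
  then have "((p @ p') @ u @ (q' @ q), (p @ p') @ v @ (q' @ q)) \<in> pres_cong X R"
    by (intro pres_cong.rel) auto
  then show ?case by simp
next
  case (refl w)
  then show ?case by (intro pres_cong.refl) auto
next
  case (sym u v)
  then show ?case by (blast intro: pres_cong.sym)
next
  case (trans u v w)
  then show ?case by (meson pres_cong.trans)
qed

lemma pres_cong_append:
  assumes "(u, u') \<in> pres_cong X R" "(v, v') \<in> pres_cong X R"
  shows "(u @ v, u' @ v') \<in> pres_cong X R"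
proof -
  have "(u @ v, u' @ v) \<in> pres_cong X R" "(u' @ v, u' @ v') \<in> pres_cong X R"
    using pres_cong_context[OF assms(1), of "[]" v] pres_cong_context[OF assms(2), of u' "[]"]
      pres_cong_lists[OF assms(1)] pres_cong_lists[OF assms(2)] by auto
  then show ?thesis by (rule pres_cong.trans)
qed

lemma pres_class_eq_iff:
  assumes "u \<in> lists X" "v \<in> lists X"
  shows "pres_class X R u = pres_class X R v \<longleftrightarrow> (u, v) \<in> pres_cong X R"
  unfolding pres_class_def using eq_equiv_class_iff[OF equiv_pres_cong assms] .

lemma pres_class_self: "w \<in> lists X \<Longrightarrow> w \<in> pres_class X R w"
  by (simp add: pres_class_def pres_cong.refl)

lemma pres_monoid_carrier: "carrier (pres_monoid X R) = pres_class X R ` lists X"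
  by (auto simp: pres_monoid_def quotient_def pres_class_def)

lemma pres_monoid_one: "\<one>\<^bsub>pres_monoid X R\<^esub> = pres_class X R []"
  by (simp add: pres_monoid_def)

lemma pres_monoid_mult:
  assumes "u \<in> lists X" "v \<in> lists X"
  shows "pres_class X R u \<otimes>\<^bsub>pres_monoid X R\<^esub> pres_class X R v = pres_class X R (u @ v)"
proof -
  have "pres_class X R (u' @ v') = pres_class X R (u @ v)"
    if "u' \<in> pres_class X R u" "v' \<in> pres_class X R v" for u' v'
  proof -
    have "(u @ v, u' @ v') \<in> pres_cong X R"
      using that unfolding pres_class_def by (intro pres_cong_append) simp_all
    with pres_cong_lists[OF this] show ?thesis
      by (metis pres_class_eq_iff)
  qed
  then have "(\<Union>u'\<in>pres_class X R u. \<Union>v'\<in>pres_class X R v. pres_class X R (u' @ v'))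
      = (\<Union>u'\<in>pres_class X R u. \<Union>v'\<in>pres_class X R v. pres_class X R (u @ v))"
    by (intro SUP_cong HOL.refl)
  also have "\<dots> = pres_class X R (u @ v)"
    using pres_class_self[OF assms(1)] pres_class_self[OF assms(2)] by blast
  finally show ?thesis by (simp add: pres_monoid_def)
qed

lemma monoid_pres_monoid: "monoid (pres_monoid X R)"
proof (rule monoidI)
  fix P Q S assume "P \<in> carrier (pres_monoid X R)" "Q \<in> carrier (pres_monoid X R)"
    "S \<in> carrier (pres_monoid X R)"
  then obtain u v w where "u \<in> lists X" "v \<in> lists X" "w \<in> lists X"
    and "P = pres_class X R u" "Q = pres_class X R v" "S = pres_class X R w"
    unfolding pres_monoid_carrier by blast
  then show "P \<otimes>\<^bsub>pres_monoid X R\<^esub> Q \<otimes>\<^bsub>pres_monoid X R\<^esub> S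
      = P \<otimes>\<^bsub>pres_monoid X R\<^esub> (Q \<otimes>\<^bsub>pres_monoid X R\<^esub> S)"
    by (simp add: pres_monoid_mult)
next
  fix P Q assume "P \<in> carrier (pres_monoid X R)" "Q \<in> carrier (pres_monoid X R)"
  then obtain u v where "u \<in> lists X" "v \<in> lists X"
    and "P = pres_class X R u" "Q = pres_class X R v"
    unfolding pres_monoid_carrier by blast
  then show "P \<otimes>\<^bsub>pres_monoid X R\<^esub> Q \<in> carrier (pres_monoid X R)"
    by (metis append_in_lists_conv imageI pres_monoid_carrier pres_monoid_mult)
next
  show "\<one>\<^bsub>pres_monoid X R\<^esub> \<in> carrier (pres_monoid X R)"
    by (simp add: pres_monoid_carrier pres_monoid_one)
next
  fix P assume "P \<in> carrier (pres_monoid X R)"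
  then obtain u where "u \<in> lists X" "P = pres_class X R u"
    unfolding pres_monoid_carrier by blast
  then show "\<one>\<^bsub>pres_monoid X R\<^esub> \<otimes>\<^bsub>pres_monoid X R\<^esub> P = P"
    and "P \<otimes>\<^bsub>pres_monoid X R\<^esub> \<one>\<^bsub>pres_monoid X R\<^esub> = P"
    using pres_monoid_mult[of "[]" X u R] pres_monoid_mult[of u X "[]" R]
    by (simp_all add: pres_monoid_one)
qed

lemma group_pres_group: "group (pres_group X R)"
proof -
  let ?L = "group_letters X" and ?S = "cancel_rels X \<union> R"
  have inv: "\<exists>v\<in>lists ?L. (v @ u, []) \<in> pres_cong ?L ?S" if "u \<in> lists ?L" for u
    using that
  proof (induction u)
    case Nil
    show ?case by (rule bexI[of _ "[]"]) (auto intro: pres_cong.refl)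
  next
    case (Cons y u)
    obtain x b where y: "y = (x, b)" "x \<in> X"
      using Cons.hyps by (auto simp: group_letters_def)
    obtain v where v: "v \<in> lists ?L" "(v @ u, []) \<in> pres_cong ?L ?S"
      using Cons.IH by blast
    let ?v = "v @ [(x, \<not> b)]"
    have "([(x, \<not> b), (x, \<not> \<not> b)], []) \<in> ?S"
      using y unfolding cancel_rels_def by blast
    then have "([(x, \<not> b), (x, b)], []) \<in> ?S" by simp
    then have "(v @ [(x, \<not> b), (x, b)] @ u, v @ [] @ u) \<in> pres_cong ?L ?S"
      by (rule pres_cong.rel) (use y v Cons in \<open>auto simp: group_letters_def\<close>)
    then have "(?v @ (y # u), []) \<in> pres_cong ?L ?S"
      using pres_cong.trans[OF _ v(2)] y by simp
    moreover have "?v \<in> lists ?L" using v y by (auto simp: group_letters_def)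
    ultimately show ?case by blast
  qed
  interpret monoid "pres_group X R"
    unfolding pres_group_def by (rule monoid_pres_monoid)
  show ?thesis
  proof (rule group_l_invI)
    fix P assume "P \<in> carrier (pres_group X R)"
    then obtain u where u: "u \<in> lists ?L" "P = pres_class ?L ?S u"
      unfolding pres_group_def pres_monoid_carrier by blast
    obtain v where v: "v \<in> lists ?L" "(v @ u, []) \<in> pres_cong ?L ?S"
      using inv[OF u(1)] by blast
    have "pres_class ?L ?S v \<otimes>\<^bsub>pres_group X R\<^esub> P = \<one>\<^bsub>pres_group X R\<^esub>"
      using u v by (simp add: pres_group_def pres_monoid_mult pres_monoid_one pres_class_eq_iff
       )
    moreover have "pres_class ?L ?S v \<in> carrier (pres_group X R)"
      using v by (auto simp: pres_group_def pres_monoid_carrier)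
    ultimately show "\<exists>y\<in>carrier (pres_group X R). y \<otimes>\<^bsub>pres_group X R\<^esub> P = \<one>\<^bsub>pres_group X R\<^esub>"
      by blast
  qed
qed


section \<open>The group \<open>G\<^sub>n\<^sup>2\<close>\<close>

definition G2_gens :: "nat \<Rightarrow> nat set set" where
  "G2_gens n = {{i, j} | i j. i \<in> {1..n} \<and> j \<in> {1..n} \<and> i \<noteq> j}"

definition aa :: "nat \<Rightarrow> nat \<Rightarrow> nat set \<times> bool" where
  "aa i j = ({i, j}, True)"

inductive_set G2_rels :: "nat \<Rightarrow> ((nat set \<times> bool) list \<times> (nat set \<times> bool) list) set"
  for n :: nat where
  square: "i \<in> {1..n} \<Longrightarrow> j \<in> {1..n} \<Longrightarrow> i \<noteq> j \<Longrightarrow> ([aa i j, aa i j], []) \<in> G2_rels n"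
| far: "{i, j, k, l} \<subseteq> {1..n} \<Longrightarrow> distinct [i, j, k, l] \<Longrightarrow>
    ([aa i j, aa k l], [aa k l, aa i j]) \<in> G2_rels n"
| tri: "{i, j, k} \<subseteq> {1..n} \<Longrightarrow> distinct [i, j, k] \<Longrightarrow>
    ([aa i j, aa i k, aa j k], [aa j k, aa i k, aa i j]) \<in> G2_rels n"

definition G2 :: "nat \<Rightarrow> (nat set \<times> bool) list set monoid" where
  "G2 n = pres_group (G2_gens n) (G2_rels n)"

definition G2_gen :: "nat \<Rightarrow> nat \<Rightarrow> nat \<Rightarrow> (nat set \<times> bool) list set" where
  "G2_gen n i j =
    pres_class (group_letters (G2_gens n)) (cancel_rels (G2_gens n) \<union> G2_rels n) [aa i j]"

lemma group_G2: "group (G2 n)"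
  unfolding G2_def by (rule group_pres_group)


section \<open>The virtual surface singular braid monoid\<close>

datatype vssb_letter = GA nat | GB nat | GC nat | GCinv nat | GV nat

definition vssb_gens :: "nat \<Rightarrow> vssb_letter set" where
  "vssb_gens n = (\<Union>x\<in>{GA, GB, GC, GCinv, GV}. x ` {1..<n})"

definition adjacent :: "nat \<Rightarrow> nat \<Rightarrow> bool" where
  "adjacent i k \<longleftrightarrow> k = i + 1 \<or> i = k + 1"

definition far_apart :: "nat \<Rightarrow> nat \<Rightarrow> bool" where
  "far_apart i j \<longleftrightarrow> i + 1 < j \<or> j + 1 < i"

definition squared :: "'a list \<Rightarrow> 'a list" where
  "squared w = w @ w"

inductive_set vssb_rels :: "nat \<Rightarrow> (vssb_letter list \<times> vssb_letter list) set" for n :: nat where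
  A1_right: "i \<in> {1..<n} \<Longrightarrow> ([GC i, GCinv i], []) \<in> vssb_rels n"
| A1_left: "i \<in> {1..<n} \<Longrightarrow> ([GCinv i, GC i], []) \<in> vssb_rels n"
| A2: "i \<in> {1..<n} \<Longrightarrow> j \<in> {1..<n} \<Longrightarrow> far_apart i j \<Longrightarrow>
    x \<in> {GA, GB, GC, GCinv} \<Longrightarrow> y \<in> {GA, GB, GC, GCinv} \<Longrightarrow>
    ([x i, y j], [y j, x i]) \<in> vssb_rels n"
| A3: "i \<in> {1..<n} \<Longrightarrow> k \<in> {1..<n} \<Longrightarrow> adjacent i k \<Longrightarrow> x \<in> {GA, GB, GC, GCinv} \<Longrightarrow>
    ([x i, GC k, GC i], [GC k, GC i, x k]) \<in> vssb_rels n"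
| A4: "i \<in> {1..<n} \<Longrightarrow> k \<in> {1..<n} \<Longrightarrow> adjacent i k \<Longrightarrow> x \<in> {GA, GB, GC, GCinv} \<Longrightarrow>
    ([x i, GCinv k, GCinv i], [GCinv k, GCinv i, x k]) \<in> vssb_rels n"
| A5: "i \<in> {1..<n} \<Longrightarrow> k \<in> {1..<n} \<Longrightarrow> adjacent i k \<Longrightarrow>
    ([GA i, GB k], [GB k, GA i]) \<in> vssb_rels n"
| A6: "i \<in> {1..<n} \<Longrightarrow> 2 < i \<Longrightarrow>
    ([GA i, GB (i - 2)] @ squared [GC (i - 1), GC (i - 2), GC i, GC (i - 1)],
     [GA i, GB (i - 2)]) \<in> vssb_rels n"
| A7: "i \<in> {1..<n} \<Longrightarrow> 2 < i \<Longrightarrow>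
    ([GB i, GA (i - 2)] @ squared [GC (i - 1), GC (i - 2), GC i, GC (i - 1)],
     [GB i, GA (i - 2)]) \<in> vssb_rels n"
| A8: "i \<in> {1..<n} \<Longrightarrow> ([GA i, GA i], [GA i]) \<in> vssb_rels n"
| A9: "i \<in> {1..<n} \<Longrightarrow> ([GB i, GB i], [GB i]) \<in> vssb_rels n"
| A10: "i \<in> {1..<n} \<Longrightarrow> ([GA i, GB i, GC i, GC i], [GA i, GB i]) \<in> vssb_rels n"
| A11: "i \<in> {1..<n} \<Longrightarrow> k \<in> {1..<n} \<Longrightarrow> adjacent i k \<Longrightarrow>
    ([GA i, GB k] @ squared [GC i, GC k, GC i], [GA i, GB k]) \<in> vssb_rels n"
| V1: "i \<in> {1..<n} \<Longrightarrow> j \<in> {1..<n} \<Longrightarrow> far_apart i j \<Longrightarrow>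
    x \<in> {GA, GB, GC, GCinv, GV} \<Longrightarrow>
    ([GV i, x j], [x j, GV i]) \<in> vssb_rels n"
| V2: "i \<in> {1..<n} \<Longrightarrow> ([GV i, GV i], []) \<in> vssb_rels n"
| V3: "i \<in> {1..<n} \<Longrightarrow> k \<in> {1..<n} \<Longrightarrow> adjacent i k \<Longrightarrow>
    x \<in> {GA, GB, GC, GCinv, GV} \<Longrightarrow>
    ([x i, GV k, GV i], [GV k, GV i, x k]) \<in> vssb_rels n"
| V4: "i \<in> {1..<n} \<Longrightarrow> x \<in> {GA, GB} \<Longrightarrow> ([x i, GV i], [GV i, x i]) \<in> vssb_rels n"

definition VSSB :: "nat \<Rightarrow> vssb_letter list set monoid" where
  "VSSB n = pres_monoid (vssb_gens n) (vssb_rels n)"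

definition vssb_class :: "nat \<Rightarrow> vssb_letter list \<Rightarrow> vssb_letter list set" where
  "vssb_class n = pres_class (vssb_gens n) (vssb_rels n)"

lemma monoid_VSSB: "monoid (VSSB n)"
  unfolding VSSB_def by (rule monoid_pres_monoid)


section \<open>The homomorphism to the symmetric group and the pure submonoid\<close>

abbreviation adj_transp :: "nat \<Rightarrow> nat \<Rightarrow> nat" where
  "adj_transp i \<equiv> Transposition.transpose i (i + 1)"

fun rho_letter :: "vssb_letter \<Rightarrow> nat \<Rightarrow> nat" where
  "rho_letter (GA i) = id"
| "rho_letter (GB i) = id"
| "rho_letter (GC i) = adj_transp i"
| "rho_letter (GCinv i) = adj_transp i"
| "rho_letter (GV i) = adj_transp i"

definition rho_word :: "vssb_letter list \<Rightarrow> nat \<Rightarrow> nat" where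
  "rho_word w = foldr (\<lambda>x p. rho_letter x \<circ> p) w id"

text \<open>The value on a congruence class is the common value on its representatives, which exists
  by \<open>rho_vssb_class\<close> below.\<close>

definition rho :: "nat \<Rightarrow> vssb_letter list set \<Rightarrow> nat \<Rightarrow> nat" where
  "rho n \<beta> = the_elem (rho_word ` \<beta>)"

definition VPSSB :: "nat \<Rightarrow> vssb_letter list set monoid" where
  "VPSSB n = (VSSB n)\<lparr>carrier := {\<beta> \<in> carrier (VSSB n). rho n \<beta> = \<one>\<^bsub>sym_group n\<^esub>}\<rparr>"

lemma rho_word_append: "rho_word (u @ v) = rho_word u \<circ> rho_word v"
  by (induction u) (simp_all add: rho_word_def comp_assoc)

lemma rho_word_double_crossing:
  "rho_word (squared [GC (j + 2), GC (j + 1), GC (j + 3), GC (j + 2)]) = id"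
proof
  fix x
  have far: "adj_transp (j + 3) (adj_transp (j + 1) y) = adj_transp (j + 1) (adj_transp (j + 3) y)" for y
    by (auto simp: Transposition.transpose_def)
  show "rho_word (squared [GC (j + 2), GC (j + 1), GC (j + 3), GC (j + 2)]) x = id x"
    unfolding squared_def rho_word_def
    by (simp only: append.simps foldr.simps o_apply id_apply rho_letter.simps
        transpose_involutory far)
qed

lemma adj_transp_braid:
  assumes "adjacent i k"
  shows "adj_transp i (adj_transp k (adj_transp i x)) = adj_transp k (adj_transp i (adj_transp k x))"
proof -
  have *: "adj_transp j (adj_transp (j + 1) (adj_transp j x))
      = adj_transp (j + 1) (adj_transp j (adj_transp (j + 1) x))" for j
  proof -
    consider "x = j" | "x = j + 1" | "x = j + 2" | "x \<noteq> j" "x \<noteq> j + 1" "x \<noteq> j + 2"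
      by blast
    then show ?thesis by cases (simp_all add: Transposition.transpose_def)
  qed
  show ?thesis using assms *[of i] *[of k] by (auto simp: adjacent_def)
qed

lemma rho_word_triangle:
  assumes "adjacent i k"
  shows "rho_word (squared [GC i, GC k, GC i]) = id"
proof
  fix x
  have "adj_transp i (adj_transp k (adj_transp i (adj_transp i (adj_transp k (adj_transp i x))))) = x"
    by simp
  then show "rho_word (squared [GC i, GC k, GC i]) x = id x"
    by (simp add: rho_word_def squared_def)
qed

lemma adj_transp_far:
  "far_apart i j \<Longrightarrow> adj_transp i (adj_transp j x) = adj_transp j (adj_transp i x)"
  by (auto simp: far_apart_def Transposition.transpose_def)

lemma rho_word_rel: "(u, v) \<in> vssb_rels n \<Longrightarrow> rho_word u = rho_word v"
proof (induction rule: vssb_rels.induct)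
  case (A6 i)
  then have "i - 1 = (i - 3) + 2" "i - 2 = (i - 3) + 1" "i = (i - 3) + 3" by auto
  then have "rho_word (squared [GC (i - 1), GC (i - 2), GC i, GC (i - 1)]) = id"
    using rho_word_double_crossing[of "i - 3"] by metis
  then show ?case by (simp only: rho_word_append comp_id)
next
  case (A7 i)
  then have "i - 1 = (i - 3) + 2" "i - 2 = (i - 3) + 1" "i = (i - 3) + 3" by auto
  then have "rho_word (squared [GC (i - 1), GC (i - 2), GC i, GC (i - 1)]) = id"
    using rho_word_double_crossing[of "i - 3"] by metis
  then show ?case by (simp only: rho_word_append comp_id)
next
  case (A11 i k)
  then show ?case by (simp only: rho_word_append rho_word_triangle comp_id)
next
  case (A2 i j x y)
  note far = adj_transp_far[OF A2(3), unfolded Suc_eq_plus1[symmetric]]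
  from A2(4-5) show ?case by (elim insertE emptyE) (simp_all add: rho_word_def comp_def far)
next
  case (A3 i k x)
  note braid = adj_transp_braid[OF A3(3), unfolded Suc_eq_plus1[symmetric]]
  from A3(4) show ?case by (elim insertE emptyE) (simp_all add: rho_word_def comp_def braid)
next
  case (A4 i k x)
  note braid = adj_transp_braid[OF A4(3), unfolded Suc_eq_plus1[symmetric]]
  from A4(4) show ?case by (elim insertE emptyE) (simp_all add: rho_word_def comp_def braid)
next
  case (V1 i j x)
  note far = adj_transp_far[OF V1(3), unfolded Suc_eq_plus1[symmetric]]
  from V1(4) show ?case by (elim insertE emptyE) (simp_all add: rho_word_def comp_def far)
next
  case (V3 i k x)
  note braid = adj_transp_braid[OF V3(3), unfolded Suc_eq_plus1[symmetric]]
  from V3(4) show ?case by (elim insertE emptyE) (simp_all add: rho_word_def comp_def braid)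
qed (auto simp: rho_word_def)

lemma rho_word_cong: "(u, v) \<in> pres_cong (vssb_gens n) (vssb_rels n) \<Longrightarrow> rho_word u = rho_word v"
  by (induction rule: pres_cong.induct) (auto simp: rho_word_append dest: rho_word_rel)

lemma rho_vssb_class:
  assumes "w \<in> lists (vssb_gens n)"
  shows "rho n (vssb_class n w) = rho_word w"
proof -
  have "rho_word ` vssb_class n w = {rho_word w}"
    using pres_class_self[OF assms, of "vssb_rels n"]
    by (fastforce simp: vssb_class_def pres_class_def dest: rho_word_cong)
  then show ?thesis by (simp add: rho_def)
qed

lemma rho_word_permutes: "w \<in> lists (vssb_gens n) \<Longrightarrow> rho_word w permutes {1..n}"
proof (induction w)
  case Nil
  have "rho_word [] = id" by (simp add: rho_word_def)
  then show ?case by (simp only: permutes_id)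
next
  case (Cons x w)
  have tr: "adj_transp i permutes {1..n}" if "i \<in> {1..<n}" for i
    using that by (intro permutes_swap_id) auto
  have "rho_letter x permutes {1..n}"
  proof (cases x)
    case (GA i) then show ?thesis by (simp only: rho_letter.simps permutes_id)
  next
    case (GB i) then show ?thesis by (simp only: rho_letter.simps permutes_id)
  next
    case (GC i) with Cons.prems tr[of i] show ?thesis by (auto simp: vssb_gens_def)
  next
    case (GCinv i) with Cons.prems tr[of i] show ?thesis by (auto simp: vssb_gens_def)
  next
    case (GV i) with Cons.prems tr[of i] show ?thesis by (auto simp: vssb_gens_def)
  qed
  moreover have "rho_word (x # w) = rho_letter x \<circ> rho_word w"
    by (simp add: rho_word_def)
  moreover have "rho_word w permutes {1..n}"
    using Cons by simp
  ultimately show ?case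
    by (metis permutes_compose)
qed

lemma rho_hom: "rho n \<in> hom (VSSB n) (sym_group n)"
proof (rule homI)
  fix \<beta> assume "\<beta> \<in> carrier (VSSB n)"
  then obtain u where "u \<in> lists (vssb_gens n)" "\<beta> = vssb_class n u"
    by (auto simp: VSSB_def pres_monoid_carrier vssb_class_def)
  then show "rho n \<beta> \<in> carrier (sym_group n)"
    by (simp only: rho_vssb_class rho_word_permutes sym_group_carrier)
next
  fix \<beta> \<gamma> assume "\<beta> \<in> carrier (VSSB n)" "\<gamma> \<in> carrier (VSSB n)"
  then obtain u v where uv: "u \<in> lists (vssb_gens n)" "\<beta> = vssb_class n u"
    "v \<in> lists (vssb_gens n)" "\<gamma> = vssb_class n v"
    unfolding VSSB_def pres_monoid_carrier vssb_class_def by blast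
  then have "\<beta> \<otimes>\<^bsub>VSSB n\<^esub> \<gamma> = vssb_class n (u @ v)"
    by (simp add: VSSB_def vssb_class_def pres_monoid_mult)
  then show "rho n (\<beta> \<otimes>\<^bsub>VSSB n\<^esub> \<gamma>) = rho n \<beta> \<otimes>\<^bsub>sym_group n\<^esub> rho n \<gamma>"
    using uv by (simp add: rho_vssb_class rho_word_append sym_group_mult)
qed

lemma rho_one: "rho n \<one>\<^bsub>VSSB n\<^esub> = \<one>\<^bsub>sym_group n\<^esub>"
  using rho_vssb_class[of "[]" n]
  by (simp add: VSSB_def pres_monoid_one vssb_class_def rho_word_def sym_group_one)

lemma submonoid_VPSSB: "submonoid (carrier (VPSSB n)) (VSSB n)"
proof -
  interpret monoid "VSSB n" by (rule monoid_VSSB)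
  interpret S: group "sym_group n" by (rule sym_group_is_group)
  show ?thesis
    by (unfold_locales) (auto simp: VPSSB_def rho_one hom_mult[OF rho_hom])
qed


section \<open>The action and the map \<open>\<phi>\<^sub>n\<close>\<close>

type_synonym g2_elt = "(nat set \<times> bool) list set"

fun act_letter :: "nat \<Rightarrow> vssb_letter \<Rightarrow> g2_elt \<times> (nat \<Rightarrow> nat) \<Rightarrow> g2_elt \<times> (nat \<Rightarrow> nat)" where
  "act_letter n (GA i) (g, \<sigma>) = (g, \<sigma>)"
| "act_letter n (GB i) (g, \<sigma>) = (g, \<sigma>)"
| "act_letter n (GC i) (g, \<sigma>) =
    (G2_gen n (\<sigma> i) (\<sigma> (i + 1)) \<otimes>\<^bsub>G2 n\<^esub> g, \<sigma> \<otimes>\<^bsub>sym_group n\<^esub> adj_transp i)"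
| "act_letter n (GCinv i) (g, \<sigma>) =
    (G2_gen n (\<sigma> i) (\<sigma> (i + 1)) \<otimes>\<^bsub>G2 n\<^esub> g, \<sigma> \<otimes>\<^bsub>sym_group n\<^esub> adj_transp i)"
| "act_letter n (GV i) (g, \<sigma>) = (g, \<sigma> \<otimes>\<^bsub>sym_group n\<^esub> adj_transp i)"

text \<open>A left action: the last letter of the word acts first.\<close>

definition act_word ::
  "nat \<Rightarrow> vssb_letter list \<Rightarrow> g2_elt \<times> (nat \<Rightarrow> nat) \<Rightarrow> g2_elt \<times> (nat \<Rightarrow> nat)" where
  "act_word n w = foldr (act_letter n) w"

definition phi_word :: "nat \<Rightarrow> vssb_letter list \<Rightarrow> g2_elt" where
  "phi_word n w = fst (act_word n w (\<one>\<^bsub>G2 n\<^esub>, \<one>\<^bsub>sym_group n\<^esub>))"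

text \<open>Meaningful only once \<^term>\<open>phi_word n\<close> is known to be constant on each congruence class,
  which is not presupposed here.\<close>

definition phi :: "nat \<Rightarrow> vssb_letter list set \<Rightarrow> g2_elt" where
  "phi n \<beta> = the_elem (phi_word n ` \<beta>)"

end

theory Submission
  imports Defs
begin

text \<open>The action is by left multiplication on the first component and by right multiplication on
  the second one. The defining relations hold for the action on all pairs \<open>(g, \<sigma>)\<close>: the braid
  relation becomes the triangle relation of \<open>G\<^sub>n\<^sup>2\<close>, far commutativity becomes far commutativity,
  and the squared words in (A6), (A7), (A10), (A11) act trivially because every strand pair occurs
  twice and cancels. Since the action commutes with right multiplication on the first component, and
  a pure element fixes the second component, \<open>\<phi>\<^sub>n\<close> is multiplicative on pure elements.\<close>

section \<open>Computing in \<open>G\<^sub>n\<^sup>2\<close>\<close>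

lemma G2_letter: "i \<in> {1..n} \<Longrightarrow> j \<in> {1..n} \<Longrightarrow> i \<noteq> j \<Longrightarrow> aa i j \<in> group_letters (G2_gens n)"
  by (auto simp: aa_def group_letters_def G2_gens_def)

lemma G2_gen_closed:
  "i \<in> {1..n} \<Longrightarrow> j \<in> {1..n} \<Longrightarrow> i \<noteq> j \<Longrightarrow> G2_gen n i j \<in> carrier (G2 n)"
  by (simp add: G2_gen_def G2_def pres_group_def pres_monoid_carrier G2_letter)

lemma G2_gen_sym: "G2_gen n i j = G2_gen n j i"
  by (simp add: G2_gen_def aa_def insert_commute)

lemma G2_class_eq:
  assumes "(u, v) \<in> G2_rels n" "u \<in> lists (group_letters (G2_gens n))"
    "v \<in> lists (group_letters (G2_gens n))"
  shows "pres_class (group_letters (G2_gens n)) (cancel_rels (G2_gens n) \<union> G2_rels n) u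
    = pres_class (group_letters (G2_gens n)) (cancel_rels (G2_gens n) \<union> G2_rels n) v"
  using pres_cong.rel[of u v "cancel_rels (G2_gens n) \<union> G2_rels n" _ "[]" "[]"] assms
  by (simp add: pres_class_eq_iff)

lemma G2_gen_square:
  assumes "i \<in> {1..n}" "j \<in> {1..n}" "i \<noteq> j"
  shows "G2_gen n i j \<otimes>\<^bsub>G2 n\<^esub> G2_gen n i j = \<one>\<^bsub>G2 n\<^esub>"
  using G2_class_eq[OF G2_rels.square[OF assms]] G2_letter[OF assms]
  by (simp add: G2_gen_def G2_def pres_group_def pres_monoid_mult pres_monoid_one)

lemma G2_gen_far:
  assumes "{i, j, k, l} \<subseteq> {1..n}" "distinct [i, j, k, l]"
  shows "G2_gen n i j \<otimes>\<^bsub>G2 n\<^esub> G2_gen n k l = G2_gen n k l \<otimes>\<^bsub>G2 n\<^esub> G2_gen n i j"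
  using G2_class_eq[OF G2_rels.far[OF assms]] G2_letter[of i n j] G2_letter[of k n l] assms
  by (simp add: G2_gen_def G2_def pres_group_def pres_monoid_mult)

lemma G2_gen_tri:
  assumes "{i, j, k} \<subseteq> {1..n}" "distinct [i, j, k]"
  shows "G2_gen n i j \<otimes>\<^bsub>G2 n\<^esub> (G2_gen n i k \<otimes>\<^bsub>G2 n\<^esub> G2_gen n j k)
    = G2_gen n j k \<otimes>\<^bsub>G2 n\<^esub> (G2_gen n i k \<otimes>\<^bsub>G2 n\<^esub> G2_gen n i j)"
  using G2_class_eq[OF G2_rels.tri[OF assms]] G2_letter[of i n j] G2_letter[of i n k]
    G2_letter[of j n k] assms
  by (simp add: G2_gen_def G2_def pres_group_def pres_monoid_mult)

text \<open>The action multiplies on the left, so its products are nested to the right with a tail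
  \<open>g\<close>. This and the next two lemmas put the relations in that form, where they can be
  applied inside a longer product.\<close>

lemma G2_gen_square_mult:
  assumes "i \<in> {1..n}" "j \<in> {1..n}" "i \<noteq> j" "g \<in> carrier (G2 n)"
  shows "G2_gen n i j \<otimes>\<^bsub>G2 n\<^esub> (G2_gen n i j \<otimes>\<^bsub>G2 n\<^esub> g) = g"
proof -
  interpret group "G2 n" by (rule group_G2)
  show ?thesis using assms G2_gen_closed
    by (simp add: m_assoc[symmetric] G2_gen_square)
qed

lemma G2_gen_far_mult:
  assumes "{i, j, k, l} \<subseteq> {1..n}" "distinct [i, j, k, l]" "g \<in> carrier (G2 n)"
  shows "G2_gen n i j \<otimes>\<^bsub>G2 n\<^esub> (G2_gen n k l \<otimes>\<^bsub>G2 n\<^esub> g)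
    = G2_gen n k l \<otimes>\<^bsub>G2 n\<^esub> (G2_gen n i j \<otimes>\<^bsub>G2 n\<^esub> g)"
proof -
  interpret group "G2 n" by (rule group_G2)
  have "G2_gen n i j \<in> carrier (G2 n)" "G2_gen n k l \<in> carrier (G2 n)"
    using assms by (auto intro: G2_gen_closed)
  then show ?thesis using G2_gen_far[OF assms(1,2)] assms(3)
    by (simp add: m_assoc[symmetric])
qed

lemma G2_gen_tri_mult:
  assumes "{i, j, k} \<subseteq> {1..n}" "distinct [i, j, k]" "g \<in> carrier (G2 n)"
  shows "G2_gen n i j \<otimes>\<^bsub>G2 n\<^esub> (G2_gen n i k \<otimes>\<^bsub>G2 n\<^esub> (G2_gen n j k \<otimes>\<^bsub>G2 n\<^esub> g))
    = G2_gen n j k \<otimes>\<^bsub>G2 n\<^esub> (G2_gen n i k \<otimes>\<^bsub>G2 n\<^esub> (G2_gen n i j \<otimes>\<^bsub>G2 n\<^esub> g))"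
proof -
  interpret group "G2 n" by (rule group_G2)
  have "G2_gen n i j \<in> carrier (G2 n)" "G2_gen n i k \<in> carrier (G2 n)"
    "G2_gen n j k \<in> carrier (G2 n)"
    using assms by (auto intro: G2_gen_closed)
  then show ?thesis using G2_gen_tri[OF assms(1,2)] assms(3)
    by (simp add: m_assoc[symmetric])
qed


section \<open>The action respects the relations\<close>

text \<open>\<open>act_letter\<close> is total; on these pairs \<sigma> is injective with values in
  range, so every crossing contributes a genuine generator.\<close>

definition g2_states :: "nat \<Rightarrow> (g2_elt \<times> (nat \<Rightarrow> nat)) set" where
  "g2_states n = carrier (G2 n) \<times> {\<sigma>. \<sigma> permutes {1..n}}"

lemma act_word_Nil [simp]: "act_word n [] s = s"
  by (simp add: act_word_def)

lemma act_word_Cons [simp]: "act_word n (x # w) s = act_letter n x (act_word n w s)"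
  by (simp add: act_word_def)

lemma act_word_append: "act_word n (u @ v) s = act_word n u (act_word n v s)"
  by (simp add: act_word_def)

lemma rho_letter_involution: "rho_letter x \<circ> rho_letter x = id"
  by (cases x) (simp_all add: fun_eq_iff)

lemma bij_rho_word: "bij (rho_word w)"
proof (induction w)
  case Nil
  have "rho_word [] = id" by (simp add: rho_word_def)
  then show ?case by (simp only: bij_id)
next
  case (Cons x w)
  have "rho_word (x # w) = rho_letter x \<circ> rho_word w" by (simp add: rho_word_def)
  with Cons show ?case
    by (metis bij_comp o_bij rho_letter_involution)
qed

text \<open>The inverse appears because the last letter acts first, but on the right of \<open>\<sigma>\<close>.\<close>

lemma snd_act_word: "snd (act_word n w (g, \<sigma>)) = \<sigma> \<circ> inv' (rho_word w)"
proof (induction w)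
  case Nil
  show ?case by (simp add: rho_word_def)
next
  case (Cons x w)
  have act: "snd (act_letter n x s) = snd s \<circ> rho_letter x" for s
    by (cases s; cases x) (simp_all add: sym_group_mult)
  have "rho_word (x # w) = rho_letter x \<circ> rho_word w"
    by (simp add: rho_word_def)
  \<comment> \<open>Inversion reverses the product, and each letter is its own inverse.\<close>
  then have "inv' (rho_word (x # w)) = inv' (rho_word w) \<circ> rho_letter x"
    by (metis bij_rho_word inv_unique_comp o_bij o_inv_distrib rho_letter_involution)
  with Cons show ?case by (simp add: act comp_assoc)
qed

lemma act_letter_states:
  assumes "x \<in> vssb_gens n" "s \<in> g2_states n"
  shows "act_letter n x s \<in> g2_states n"
proof -
  interpret group "G2 n" by (rule group_G2)
  obtain g \<sigma> where s: "s = (g, \<sigma>)" "g \<in> carrier (G2 n)" "\<sigma> permutes {1..n}"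
    using assms(2) by (auto simp: g2_states_def)
  have tr: "adj_transp i permutes {1..n}" if "i \<in> {1..<n}" for i
    using that by (intro permutes_swap_id) auto
  have gen: "G2_gen n (\<sigma> i) (\<sigma> (i + 1)) \<in> carrier (G2 n)" if "i \<in> {1..<n}" for i
    using that permutes_in_image[OF s(3)] permutes_inj[OF s(3)]
    by (intro G2_gen_closed) (auto simp: inj_eq)
  obtain i where "i \<in> {1..<n}" "x \<in> {GA i, GB i, GC i, GCinv i, GV i}"
    using assms(1) by (auto simp: vssb_gens_def)
  then show ?thesis
    using s gen[of i] permutes_compose[OF tr s(3), of i]
    by (auto simp: g2_states_def sym_group_mult)
qed

lemma act_word_states:
  "w \<in> lists (vssb_gens n) \<Longrightarrow> s \<in> g2_states n \<Longrightarrow> act_word n w s \<in> g2_states n"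
  by (induction w) (simp_all add: act_letter_states)

text \<open>The word carries two neighbouring strands past the next two and back. Each of the four
  mixed pairs crosses twice, and the generators cancel from the middle outwards after one far
  commutation.\<close>

lemma double_crossing_act:
  assumes "i \<in> {1..<n}" "2 < i" "s \<in> g2_states n"
  shows "fst (act_word n (squared [GC (i - 1), GC (i - 2), GC i, GC (i - 1)]) s) = fst s"
proof -
  interpret group "G2 n" by (rule group_G2)
  obtain g \<sigma> where s: "s = (g, \<sigma>)" "g \<in> carrier (G2 n)" "\<sigma> permutes {1..n}"
    using assms(3) by (auto simp: g2_states_def)
  \<comment> \<open>Counting from the leftmost strand \<open>j\<close> removes the truncated
    subtractions.\<close>
  define j where "j = i - 2"
  have i: "i = Suc (Suc j)" and j: "1 \<le> j" "Suc (Suc j) < n"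
    using assms by (auto simp: j_def)
  define p q r t where pqrt: "p = \<sigma> j" "q = \<sigma> (Suc j)" "r = \<sigma> (Suc (Suc j))"
    "t = \<sigma> (Suc (Suc (Suc j)))"
  have mem: "{p, q, r, t} \<subseteq> {1..n}"
    using permutes_in_image[OF s(3)] j by (auto simp: pqrt)
  have dist: "distinct [p, q, r, t]"
    using permutes_inj[OF s(3)] by (auto simp: pqrt inj_eq)
  have closed: "G2_gen n x y \<in> carrier (G2 n)" if "x \<noteq> y" "{x, y} \<subseteq> {p, q, r, t}" for x y
    using that mem by (intro G2_gen_closed) auto
  have cancel: "G2_gen n x y \<otimes>\<^bsub>G2 n\<^esub> (G2_gen n x y \<otimes>\<^bsub>G2 n\<^esub> h) = h"
    if "x \<noteq> y" "{x, y} \<subseteq> {p, q, r, t}" "h \<in> carrier (G2 n)" for x y h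
    using that mem by (intro G2_gen_square_mult) auto
  \<comment> \<open>The second pass meets the pairs \<open>p, r\<close> and \<open>q, t\<close> in
    the same order as the first, not mirrored, so these disjoint pairs have to be exchanged.\<close>
  have swap: "G2_gen n q t \<otimes>\<^bsub>G2 n\<^esub> (G2_gen n p r \<otimes>\<^bsub>G2 n\<^esub> h)
      = G2_gen n p r \<otimes>\<^bsub>G2 n\<^esub> (G2_gen n q t \<otimes>\<^bsub>G2 n\<^esub> h)" if "h \<in> carrier (G2 n)" for h
    using that mem dist by (intro G2_gen_far_mult) auto
  \<comment> \<open>Read from the right: the first four crossings turn the order
    \<open>p q r t\<close> into \<open>r t p q\<close>, the last four restore it.\<close>
  have "fst (act_word n (squared [GC (i - 1), GC (i - 2), GC i, GC (i - 1)]) s)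
      = G2_gen n r q \<otimes>\<^bsub>G2 n\<^esub> (G2_gen n r p \<otimes>\<^bsub>G2 n\<^esub> (G2_gen n t q \<otimes>\<^bsub>G2 n\<^esub> (G2_gen n t p \<otimes>\<^bsub>G2 n\<^esub>
        (G2_gen n p t \<otimes>\<^bsub>G2 n\<^esub> (G2_gen n p r \<otimes>\<^bsub>G2 n\<^esub> (G2_gen n q t \<otimes>\<^bsub>G2 n\<^esub> (G2_gen n q r \<otimes>\<^bsub>G2 n\<^esub> g)))))))"
    by (simp add: s(1) i squared_def sym_group_mult pqrt)
  also have "\<dots> = g"
    using dist s(2)
    unfolding G2_gen_sym[of n r q] G2_gen_sym[of n r p] G2_gen_sym[of n t q] G2_gen_sym[of n t p]
    by (simp add: closed cancel swap)
  finally show ?thesis by (simp add: s(1))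
qed

text \<open>The squared word is a palindrome and each crossing acts as an involution, so the six
  generators cancel from the middle outwards.\<close>

lemma triangle_act:
  assumes "i \<in> {1..<n}" "k \<in> {1..<n}" "adjacent i k" "s \<in> g2_states n"
  shows "fst (act_word n (squared [GC i, GC k, GC i]) s) = fst s"
proof -
  interpret group "G2 n" by (rule group_G2)
  obtain g \<sigma> where s: "s = (g, \<sigma>)" "g \<in> carrier (G2 n)" "\<sigma> permutes {1..n}"
    using assms(4) by (auto simp: g2_states_def)
  \<comment> \<open>The second form is for a pair that is met again with its strands in reversed
    order.\<close>
  have cancel: "G2_gen n (\<sigma> x) (\<sigma> y) \<otimes>\<^bsub>G2 n\<^esub> (G2_gen n (\<sigma> x) (\<sigma> y) \<otimes>\<^bsub>G2 n\<^esub> h) = h"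
    "G2_gen n (\<sigma> x) (\<sigma> y) \<otimes>\<^bsub>G2 n\<^esub> (G2_gen n (\<sigma> y) (\<sigma> x) \<otimes>\<^bsub>G2 n\<^esub> h) = h"
    "G2_gen n (\<sigma> x) (\<sigma> y) \<in> carrier (G2 n)"
    if "x \<noteq> y" "1 \<le> x" "1 \<le> y" "x \<le> n" "y \<le> n" "h \<in> carrier (G2 n)" for x y h
    using that permutes_in_image[OF s(3)] permutes_inj[OF s(3)]
      G2_gen_square_mult[of "\<sigma> x" n "\<sigma> y"] G2_gen_closed[of "\<sigma> x" n "\<sigma> y"]
      G2_gen_sym[of n "\<sigma> x" "\<sigma> y"]
    by (auto simp: inj_eq)
  show ?thesis using assms(1-3) s(2)
    by (auto simp: adjacent_def squared_def s(1) sym_group_mult cancel)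
qed

lemma fst_act_GA_GB:
  "fst (act_letter n (GA i) s) = fst s" "fst (act_letter n (GB i) s) = fst s"
  by (cases s; simp)+

lemma fst_act_word_rel:
  assumes "(u, v) \<in> vssb_rels n" "s \<in> g2_states n"
  shows "fst (act_word n u s) = fst (act_word n v s)"
proof -
  interpret group "G2 n" by (rule group_G2)
  obtain g \<sigma> where s: "s = (g, \<sigma>)" "g \<in> carrier (G2 n)" "\<sigma> permutes {1..n}"
    using assms(2) by (auto simp: g2_states_def)
  have mem: "Suc 0 \<le> \<sigma> i" "\<sigma> i \<le> n" if "1 \<le> i" "i \<le> n" for i
    using that permutes_in_image[OF s(3), of i] by auto
  have eq: "\<sigma> i = \<sigma> j \<longleftrightarrow> i = j" for i j
    using permutes_inj[OF s(3)] by (simp add: inj_eq)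
  \<comment> \<open>The two sides of a braid relation cross the same three pairs in opposite
    orders.\<close>
  have braid: "G2_gen n (\<sigma> (Suc i)) (\<sigma> (Suc (Suc i))) \<otimes>\<^bsub>G2 n\<^esub>
        (G2_gen n (\<sigma> i) (\<sigma> (Suc (Suc i))) \<otimes>\<^bsub>G2 n\<^esub> (G2_gen n (\<sigma> i) (\<sigma> (Suc i)) \<otimes>\<^bsub>G2 n\<^esub> g))
     = G2_gen n (\<sigma> i) (\<sigma> (Suc i)) \<otimes>\<^bsub>G2 n\<^esub>
        (G2_gen n (\<sigma> i) (\<sigma> (Suc (Suc i))) \<otimes>\<^bsub>G2 n\<^esub>
          (G2_gen n (\<sigma> (Suc i)) (\<sigma> (Suc (Suc i))) \<otimes>\<^bsub>G2 n\<^esub> g))" if "1 \<le> i" "Suc i < n" for i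
    using that s(2) by (intro G2_gen_tri_mult[symmetric]) (auto simp: mem eq)
  have far: "G2_gen n (\<sigma> i) (\<sigma> (Suc i)) \<otimes>\<^bsub>G2 n\<^esub> (G2_gen n (\<sigma> j) (\<sigma> (Suc j)) \<otimes>\<^bsub>G2 n\<^esub> g)
     = G2_gen n (\<sigma> j) (\<sigma> (Suc j)) \<otimes>\<^bsub>G2 n\<^esub> (G2_gen n (\<sigma> i) (\<sigma> (Suc i)) \<otimes>\<^bsub>G2 n\<^esub> g)"
    if "i \<in> {1..<n}" "j \<in> {1..<n}" "far_apart i j" for i j
    using that s(2) by (intro G2_gen_far_mult) (auto simp: mem eq far_apart_def)
  show ?thesis using assms(1)
  proof cases
    case (A2 i j x y)
    \<comment> \<open>Neither transposition moves the two positions that the other letter reads, so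
      both orders use the same strand labels.\<close>
    have "adj_transp i j = j" "adj_transp i (Suc j) = Suc j"
      "adj_transp j i = i" "adj_transp j (Suc i) = Suc i"
      using A2(5) by (auto simp: far_apart_def Transposition.transpose_def)
    with A2(6,7) far[OF A2(3-5)] show ?thesis
      unfolding A2(1,2) by (elim insertE emptyE) (simp_all add: s(1) sym_group_mult)
  next
    case (A3 i k x)
    then show ?thesis using braid[of i] braid[of k]
      by (auto simp: adjacent_def s(1) sym_group_mult G2_gen_sym)
  next
    case (A4 i k x)
    then show ?thesis using braid[of i] braid[of k]
      by (auto simp: adjacent_def s(1) sym_group_mult G2_gen_sym)
  next
    case (A6 i)
    with double_crossing_act[OF A6(3,4) assms(2)] show ?thesis
      by (simp add: act_word_append fst_act_GA_GB)
  next
    case (A7 i)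
    with double_crossing_act[OF A7(3,4) assms(2)] show ?thesis
      by (simp add: act_word_append fst_act_GA_GB)
  next
    case (A11 i k)
    with triangle_act[OF A11(3-5) assms(2)] show ?thesis
      by (simp add: act_word_append fst_act_GA_GB)
  next
    case (V1 i j x)
    then show ?thesis
      by (auto simp: far_apart_def s(1) sym_group_mult)
  next
    case (V3 i k x)
    \<comment> \<open>Virtual letters only permute labels. Each side has at most one crossing, and
      it meets the same pair of strands on both sides.\<close>
    then show ?thesis
      by (auto simp: adjacent_def s(1) sym_group_mult)
  next
    case (V4 i x)
    then show ?thesis
      by (auto simp: s(1) sym_group_mult)
  \<comment> \<open>In \<open>A1_right\<close>, \<open>A1_left\<close> and \<open>A10\<close> one
    pair crosses twice; the other remaining cases produce no generator.\<close>
  qed (simp_all add: s(1,2) mem eq sym_group_mult G2_gen_square_mult G2_gen_sym)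
qed

lemma snd_act_word_rel:
  assumes "(u, v) \<in> vssb_rels n"
  shows "snd (act_word n u s) = snd (act_word n v s)"
  by (cases s) (simp add: snd_act_word rho_word_rel[OF assms])

text \<open>Inside a context the right factor \<open>q\<close> acts first, so the relation is
  applied at a shifted state; hence the induction runs over all states.\<close>

lemma act_word_cong:
  assumes "(u, v) \<in> pres_cong (vssb_gens n) (vssb_rels n)" "s \<in> g2_states n"
  shows "act_word n u s = act_word n v s"
  using assms
proof (induction arbitrary: s rule: pres_cong.induct)
  case (rel u v p q)
  have "act_word n u (act_word n q s) = act_word n v (act_word n q s)"
    using rel act_word_states[OF \<open>q \<in> _\<close> rel.prems]
    by (intro prod_eqI fst_act_word_rel snd_act_word_rel)
  then show ?case by (simp add: act_word_append)
qed simp_all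

section \<open>Descent from words to congruence classes\<close>

lemma one_state: "(\<one>\<^bsub>G2 n\<^esub>, \<one>\<^bsub>sym_group n\<^esub>) \<in> g2_states n"
proof -
  interpret group "G2 n" by (rule group_G2)
  show ?thesis unfolding g2_states_def sym_group_one using permutes_id by auto
qed

lemma phi_word_cong:
  "(u, v) \<in> pres_cong (vssb_gens n) (vssb_rels n) \<Longrightarrow> phi_word n u = phi_word n v"
  by (simp add: phi_word_def act_word_cong one_state)

lemma phi_word_closed: "w \<in> lists (vssb_gens n) \<Longrightarrow> phi_word n w \<in> carrier (G2 n)"
  using act_word_states[OF _ one_state] by (fastforce simp: phi_word_def g2_states_def)

lemma phi_vssb_class:
  assumes "w \<in> lists (vssb_gens n)"
  shows "phi n (vssb_class n w) = phi_word n w"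
proof -
  have "phi_word n ` vssb_class n w = {phi_word n w}"
    using pres_class_self[OF assms, of "vssb_rels n"]
    by (fastforce simp: vssb_class_def pres_class_def dest: phi_word_cong)
  then show ?thesis by (simp add: phi_def)
qed


section \<open>Multiplicativity on pure elements\<close>

text \<open>Letters multiply \<open>g\<close> on the left by factors that depend only on the second
  component, and associativity lets \<open>h\<close> pass through.\<close>

lemma fst_act_word_mult_right:
  assumes "w \<in> lists (vssb_gens n)" "\<sigma> permutes {1..n}" "g \<in> carrier (G2 n)" "h \<in> carrier (G2 n)"
  shows "fst (act_word n w (g \<otimes>\<^bsub>G2 n\<^esub> h, \<sigma>)) = fst (act_word n w (g, \<sigma>)) \<otimes>\<^bsub>G2 n\<^esub> h"
  using assms(1)
proof (induction w)
  case Nil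
  show ?case by simp
next
  case (Cons x w)
  interpret group "G2 n" by (rule group_G2)
  obtain g' \<tau> where s: "act_word n w (g, \<sigma>) = (g', \<tau>)" by fastforce
  have st: "(g', \<tau>) \<in> g2_states n"
    using act_word_states[of w n "(g, \<sigma>)"] Cons assms s by (auto simp: g2_states_def)
  \<comment> \<open>By \<open>snd_act_word\<close> the second component does not depend on the
    first, so both runs read the same labels.\<close>
  have "snd (act_word n w (g \<otimes>\<^bsub>G2 n\<^esub> h, \<sigma>)) = \<tau>"
    using s snd_act_word by (metis snd_conv)
  then have s': "act_word n w (g \<otimes>\<^bsub>G2 n\<^esub> h, \<sigma>) = (g' \<otimes>\<^bsub>G2 n\<^esub> h, \<tau>)"
    using Cons s by (intro prod_eqI) auto
  have gen: "G2_gen n (\<tau> i) (\<tau> (Suc i)) \<in> carrier (G2 n)" if "i \<in> {1..<n}" for i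
    using that st permutes_in_image[of \<tau> "{1..n}"] permutes_inj[of \<tau> "{1..n}"]
    by (intro G2_gen_closed) (auto simp: inj_eq g2_states_def)
  obtain i where "i \<in> {1..<n}" "x \<in> {GA i, GB i, GC i, GCinv i, GV i}"
    using Cons.hyps by (auto simp: vssb_gens_def)
  then show ?case using gen[of i] st assms(4)
    by (auto simp: s s' g2_states_def m_assoc)
qed

lemma phi_word_append_pure:
  assumes "u \<in> lists (vssb_gens n)" "v \<in> lists (vssb_gens n)" "rho_word v = id"
  shows "phi_word n (u @ v) = phi_word n u \<otimes>\<^bsub>G2 n\<^esub> phi_word n v"
proof -
  interpret group "G2 n" by (rule group_G2)
  have "act_word n v (\<one>\<^bsub>G2 n\<^esub>, id) = (phi_word n v, id)"
    using assms(3) by (intro prod_eqI) (simp_all add: phi_word_def sym_group_one snd_act_word)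
  \<comment> \<open>The unit factor is inserted so that \<open>phi_word n v\<close> appears as a
    right multiplier of the base state of \<open>u\<close>.\<close>
  then have "phi_word n (u @ v) = fst (act_word n u (\<one>\<^bsub>G2 n\<^esub> \<otimes>\<^bsub>G2 n\<^esub> phi_word n v, id))"
    using phi_word_closed[OF assms(2)] by (simp add: phi_word_def sym_group_one act_word_append)
  also have "\<dots> = phi_word n u \<otimes>\<^bsub>G2 n\<^esub> phi_word n v"
    using fst_act_word_mult_right[OF assms(1) permutes_id _ phi_word_closed[OF assms(2)]]
    by (simp add: phi_word_def sym_group_one)
  finally show ?thesis .
qed

lemma phi_hom: "phi n \<in> hom (VPSSB n) (G2 n)"
proof (rule homI)
  fix \<beta> assume "\<beta> \<in> carrier (VPSSB n)"
  then obtain u where "u \<in> lists (vssb_gens n)" "\<beta> = vssb_class n u"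
    by (auto simp: VPSSB_def VSSB_def pres_monoid_carrier vssb_class_def)
  then show "phi n \<beta> \<in> carrier (G2 n)"
    by (simp only: phi_vssb_class phi_word_closed)
next
  fix \<beta> \<gamma> assume "\<beta> \<in> carrier (VPSSB n)" "\<gamma> \<in> carrier (VPSSB n)"
  then obtain u v where uv: "u \<in> lists (vssb_gens n)" "\<beta> = vssb_class n u"
    "v \<in> lists (vssb_gens n)" "\<gamma> = vssb_class n v" "rho n (vssb_class n v) = id"
    by (auto simp: VPSSB_def VSSB_def pres_monoid_carrier vssb_class_def sym_group_one)
  then have "\<beta> \<otimes>\<^bsub>VPSSB n\<^esub> \<gamma> = vssb_class n (u @ v)" "rho_word v = id"
    by (simp_all add: VPSSB_def VSSB_def vssb_class_def pres_monoid_mult flip: rho_vssb_class)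
  then show "phi n (\<beta> \<otimes>\<^bsub>VPSSB n\<^esub> \<gamma>) = phi n \<beta> \<otimes>\<^bsub>G2 n\<^esub> phi n \<gamma>"
    using uv by (simp add: phi_vssb_class phi_word_append_pure)
qed

text \<open>\<open>hom\<close> records multiplicativity only. The unit is the class of the empty
  word, which leaves the base state fixed.\<close>

lemma phi_one: "phi n \<one>\<^bsub>VPSSB n\<^esub> = \<one>\<^bsub>G2 n\<^esub>"
  using phi_vssb_class[of "[]" n]
  by (simp add: VPSSB_def VSSB_def pres_monoid_one vssb_class_def phi_word_def)

theorem proposition5p3:
  fixes n :: nat
  assumes "n \<ge> 2"
  shows "((\<forall>u \<in> lists (vssb_gens n). \<forall>w \<in> lists (vssb_gens n).
             vssb_class n u = vssb_class n w \<longrightarrow> phi_word n u = phi_word n w)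
          \<and> (\<forall>w \<in> lists (vssb_gens n). phi n (vssb_class n w) = phi_word n w)
          \<and> phi n \<in> carrier (VSSB n) \<rightarrow> carrier (G2 n))
       \<and> (phi n \<in> hom (VPSSB n) (G2 n) \<and> phi n \<one>\<^bsub>VPSSB n\<^esub> = \<one>\<^bsub>G2 n\<^esub>)"
proof -
  have "phi_word n u = phi_word n w"
    if "u \<in> lists (vssb_gens n)" "w \<in> lists (vssb_gens n)" "vssb_class n u = vssb_class n w" for u w
    using that by (metis phi_vssb_class)
  moreover have "phi n \<in> carrier (VSSB n) \<rightarrow> carrier (G2 n)"
  proof
    fix \<beta> assume "\<beta> \<in> carrier (VSSB n)"
    then obtain u where "u \<in> lists (vssb_gens n)" "\<beta> = vssb_class n u"
      by (auto simp: VSSB_def pres_monoid_carrier vssb_class_def)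
    then show "phi n \<beta> \<in> carrier (G2 n)"
      by (simp only: phi_vssb_class phi_word_closed)
  qed
  ultimately show ?thesis
    using phi_vssb_class phi_hom phi_one by blast
qed

end
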